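(* Let $a,b\in\mathbb{H}$ be similar (nonreal) quaternions and let $c\in\mathbb{H}$ be a nonzero quaternion. Then the equation $ax-xb=c$ has a solution $x\in\mathbb{H}$ if and only if $ac=cb^{*}$.
   Context: $\mathbb{H}$ is the real quaternion algebra and $b^*$ denotes the quaternion conjugate of $b$. Two nonreal quaternions $a,b$ are called similar if there is a nonzero quaternion $p$ with $p^{-1}ap=b$. *)

theory Defs
  imports Complex_Main
begin

text \<open>The real quaternion algebra, with a quaternion \<open>w + x i + y j + z k\<close> represented by its four
  real coordinates.\<close>

datatype quat = Quat (qRe: real) (qIm1: real) (qIm2: real) (qIm3: real)

lemma quat_eq_iff:
  "p = q \<longleftrightarrow> qRe p = qRe q \<and> qIm1 p = qIm1 q \<and> qIm2 p = qIm2 q \<and> qIm3 p = qIm3 q"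
  by (cases p; cases q) simp

definition quat_cnj :: "quat \<Rightarrow> quat" where
  "quat_cnj q = Quat (qRe q) (- qIm1 q) (- qIm2 q) (- qIm3 q)"

definition quat_normsq :: "quat \<Rightarrow> real" where
  "quat_normsq q = (qRe q)\<^sup>2 + (qIm1 q)\<^sup>2 + (qIm2 q)\<^sup>2 + (qIm3 q)\<^sup>2"

lemma quat_cnj_sel [simp]:
  "qRe (quat_cnj q) = qRe q" "qIm1 (quat_cnj q) = - qIm1 q"
  "qIm2 (quat_cnj q) = - qIm2 q" "qIm3 (quat_cnj q) = - qIm3 q"
  by (simp_all add: quat_cnj_def)

instantiation quat :: real_div_algebra
begin

definition zero_quat :: quat where "0 = Quat 0 0 0 0"

definition one_quat :: quat where "1 = Quat 1 0 0 0"

definition plus_quat :: "quat \<Rightarrow> quat \<Rightarrow> quat" where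
  "p + q = Quat (qRe p + qRe q) (qIm1 p + qIm1 q) (qIm2 p + qIm2 q) (qIm3 p + qIm3 q)"

definition uminus_quat :: "quat \<Rightarrow> quat" where
  "- q = Quat (- qRe q) (- qIm1 q) (- qIm2 q) (- qIm3 q)"

definition minus_quat :: "quat \<Rightarrow> quat \<Rightarrow> quat" where
  "p - q = Quat (qRe p - qRe q) (qIm1 p - qIm1 q) (qIm2 p - qIm2 q) (qIm3 p - qIm3 q)"

definition scaleR_quat :: "real \<Rightarrow> quat \<Rightarrow> quat" where
  "r *\<^sub>R q = Quat (r * qRe q) (r * qIm1 q) (r * qIm2 q) (r * qIm3 q)"

text \<open>Hamilton's product: \<open>i\<^sup>2 = j\<^sup>2 = k\<^sup>2 = ijk = -1\<close>.\<close>

definition times_quat :: "quat \<Rightarrow> quat \<Rightarrow> quat" where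
  "p * q = Quat
     (qRe p * qRe q - qIm1 p * qIm1 q - qIm2 p * qIm2 q - qIm3 p * qIm3 q)
     (qRe p * qIm1 q + qIm1 p * qRe q + qIm2 p * qIm3 q - qIm3 p * qIm2 q)
     (qRe p * qIm2 q - qIm1 p * qIm3 q + qIm2 p * qRe q + qIm3 p * qIm1 q)
     (qRe p * qIm3 q + qIm1 p * qIm2 q - qIm2 p * qIm1 q + qIm3 p * qRe q)"

definition inverse_quat :: "quat \<Rightarrow> quat" where
  "inverse q = inverse (quat_normsq q) *\<^sub>R quat_cnj q"

definition divide_quat :: "quat \<Rightarrow> quat \<Rightarrow> quat" where
  "p div q = p * inverse q" for p q :: quat

lemmas quat_ops_defs = zero_quat_def one_quat_def plus_quat_def uminus_quat_def minus_quat_def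
  scaleR_quat_def times_quat_def

lemma quat_normsq_pos: "q \<noteq> 0 \<Longrightarrow> quat_normsq q > 0"
proof -
  assume "q \<noteq> 0"
  then have "qRe q \<noteq> 0 \<or> qIm1 q \<noteq> 0 \<or> qIm2 q \<noteq> 0 \<or> qIm3 q \<noteq> 0"
    by (simp add: quat_eq_iff zero_quat_def)
  then show ?thesis
    unfolding quat_normsq_def
    by (smt (verit) zero_le_power2 zero_less_power2)
qed

instance
proof
  fix p q r :: quat and s t :: real
  show "p + q + r = p + (q + r)" "p + q = q + p" "0 + p = p" "- p + p = 0" "p - q = p + - q"
    by (simp_all add: quat_ops_defs)
  show "s *\<^sub>R (p + q) = s *\<^sub>R p + s *\<^sub>R q" "(s + t) *\<^sub>R p = s *\<^sub>R p + t *\<^sub>R p"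
    "s *\<^sub>R t *\<^sub>R p = (s * t) *\<^sub>R p" "1 *\<^sub>R p = p"
    by (simp_all add: quat_ops_defs algebra_simps)
  show "p * q * r = p * (q * r)" "(p + q) * r = p * r + q * r" "p * (q + r) = p * q + p * r"
    "s *\<^sub>R p * q = s *\<^sub>R (p * q)" "p * s *\<^sub>R q = s *\<^sub>R (p * q)"
    by (simp_all add: quat_ops_defs algebra_simps)
  show "1 * p = p" "p * 1 = p" "(0::quat) \<noteq> 1"
    by (simp_all add: quat_ops_defs)
  show "inverse p * p = 1" "p * inverse p = 1" if "p \<noteq> 0"
  proof -
    define n where "n = quat_normsq p"
    have n: "n \<noteq> 0" and eq: "qRe p * qRe p + qIm1 p * qIm1 p + qIm2 p * qIm2 p + qIm3 p * qIm3 p = n"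
      using quat_normsq_pos[OF that] by (simp_all add: n_def quat_normsq_def power2_eq_square)
    have "quat_cnj p * p = n *\<^sub>R 1" "p * quat_cnj p = n *\<^sub>R 1"
      using eq by (simp_all add: quat_ops_defs algebra_simps)
    moreover have "s *\<^sub>R p * q = s *\<^sub>R (p * q)" "p * s *\<^sub>R q = s *\<^sub>R (p * q)"
      "s *\<^sub>R t *\<^sub>R p = (s * t) *\<^sub>R p" "1 *\<^sub>R p = p" for s t and p q :: quat
      by (simp_all add: quat_ops_defs algebra_simps)
    ultimately show "inverse p * p = 1" "p * inverse p = 1"
      using n by (simp_all add: inverse_quat_def flip: n_def)
  qed
  show "p div q = p * inverse q"
    by (simp add: divide_quat_def)
  show "inverse (0::quat) = 0"
    by (simp add: inverse_quat_def quat_ops_defs quat_cnj_def quat_normsq_def)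
qed

end

text \<open>Similarity is used for nonreal quaternions; nonreality is not built into the relation but is
  stated separately.\<close>

definition similar_quat :: "quat \<Rightarrow> quat \<Rightarrow> bool" where
  "similar_quat a b \<longleftrightarrow> (\<exists>p. p \<noteq> 0 \<and> inverse p * a * p = b)"

lemma quat_Reals_iff: "q \<in> \<real> \<longleftrightarrow> qIm1 q = 0 \<and> qIm2 q = 0 \<and> qIm3 q = 0"
proof
  assume "q \<in> \<real>"
  then show "qIm1 q = 0 \<and> qIm2 q = 0 \<and> qIm3 q = 0"
    by (auto simp: Reals_def of_real_def quat_ops_defs)
next
  assume "qIm1 q = 0 \<and> qIm2 q = 0 \<and> qIm3 q = 0"
  then have "q = of_real (qRe q)"
    by (simp add: quat_eq_iff of_real_def quat_ops_defs)
  then show "q \<in> \<real>"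
    by (metis Reals_of_real)
qed

end

theory Submission
  imports Defs
begin

text \<open>
  Similar quaternions have the same trace \<open>t = a + a\<^sup>*\<close> and the same norm \<open>n = a a\<^sup>*\<close>. If
  \<open>c = a x - x b\<close>, then \<open>a c - c b\<^sup>* = a\<^sup>2 x - a x (b + b\<^sup>*) + x b b\<^sup>* = (a\<^sup>2 - t a + n) x = 0\<close>.
  Conversely, \<open>a c = c b\<^sup>*\<close> yields \<open>c b = c (t - b\<^sup>*) = (t - a) c = a\<^sup>* c\<close>, so that
  \<open>a c - c b = (a - a\<^sup>*) c\<close>. As \<open>a\<close> is not real, \<open>a - a\<^sup>*\<close> is invertible, and its inverse commutes
  with \<open>a\<close>; hence \<open>x = (a - a\<^sup>*)\<^sup>-\<^sup>1 c\<close> is a solution.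
\<close>

lemma quat_add_cnj: "q + quat_cnj q = of_real (2 * qRe q)"
  by (simp add: of_real_def quat_ops_defs quat_cnj_def del: of_real_mult)

lemma quat_mult_cnj: "q * quat_cnj q = of_real (quat_normsq q)"
  by (simp add: of_real_def quat_ops_defs quat_cnj_def quat_normsq_def power2_eq_square)

lemma quat_cnj_eq: "quat_cnj q = of_real (2 * qRe q) - q"
  by (metis quat_add_cnj add_diff_cancel_left')

lemma quat_cnj_eq_self_iff: "quat_cnj q = q \<longleftrightarrow> q \<in> \<real>"
  by (auto simp: quat_eq_iff quat_Reals_iff)

lemma quat_normsq_mult: "quat_normsq (p * q) = quat_normsq p * quat_normsq q"
  by (simp add: quat_normsq_def times_quat_def power2_eq_square algebra_simps)

lemma qRe_mult_commute: "qRe (p * q) = qRe (q * p)"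
  by (simp add: times_quat_def algebra_simps)

text \<open>The real part acts as a trace: cyclic invariance brings \<open>p\<close> next to
  \<open>inverse p\<close>.\<close>

lemma similar_quat_qRe:
  assumes "similar_quat a b"
  shows "qRe a = qRe b"
proof -
  obtain p where p: "p \<noteq> 0" "inverse p * a * p = b"
    using assms by (auto simp: similar_quat_def)
  have "qRe b = qRe (p * (inverse p * a))"
    using p(2) qRe_mult_commute by metis
  also have "p * (inverse p * a) = a"
    using p(1) by (simp flip: mult.assoc)
  finally show ?thesis ..
qed

text \<open>Multiplicativity on \<open>p * b = a * p\<close>, then cancel the positive norm of
  \<open>p\<close>.\<close>

lemma similar_quat_normsq:
  assumes "similar_quat a b"
  shows "quat_normsq a = quat_normsq b"
proof -
  obtain p where p: "p \<noteq> 0" "inverse p * a * p = b"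
    using assms by (auto simp: similar_quat_def)
  then have "p * b = a * p"
    by (auto simp flip: mult.assoc)
  then have "quat_normsq p * quat_normsq b = quat_normsq a * quat_normsq p"
    by (metis quat_normsq_mult)
  then show ?thesis
    using quat_normsq_pos[OF p(1)] by simp
qed

theorem lemma5p1:
  fixes a b c :: quat
  assumes "a \<notin> \<real>" and "b \<notin> \<real>"
    and "similar_quat a b"
    and "c \<noteq> 0"
  shows "(\<exists>x. a * x - x * b = c) \<longleftrightarrow> a * c = c * quat_cnj b"
proof
  define t :: quat where "t = of_real (2 * qRe a)"
  define n :: quat where "n = of_real (quat_normsq a)"
  \<comment> \<open>Both are real, hence central.\<close>
  have t_comm: "t * q = q * t" and n_comm: "n * q = q * n" for q
    unfolding t_def n_def by (simp_all add: of_real_def)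
  have cnj_a: "quat_cnj a = t - a"
    by (simp add: t_def quat_cnj_eq)
  have cnj_b: "quat_cnj b = t - b"
    using similar_quat_qRe[OF assms(3)] by (simp add: t_def quat_cnj_eq)
  have norm_a: "a * (t - a) = n"
    using quat_mult_cnj[of a] by (simp add: cnj_a n_def)
  have norm_b: "b * (t - b) = n"
    using quat_mult_cnj[of b] similar_quat_normsq[OF assms(3)] by (simp add: cnj_b n_def)
  {
    assume "\<exists>x. a * x - x * b = c"
    then obtain x where c: "c = a * x - x * b" by blast
    \<comment> \<open>The two mixed terms \<open>a * x * b\<close> cancel; what remains will be
      \<open>x * n - n * x\<close>.\<close>
    have "a * c - c * (t - b) = x * (b * (t - b)) - (a * (x * t) - a * (a * x))"
      by (simp add: c algebra_simps)
    also have "a * (x * t) - a * (a * x) = a * (t - a) * x"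
      by (simp add: algebra_simps t_comm)
    finally have "a * c - c * (t - b) = 0"
      by (simp add: norm_a norm_b n_comm)
    then show "a * c = c * quat_cnj b"
      by (simp add: cnj_b)
  next
    assume ac: "a * c = c * quat_cnj b"
    define d where "d = a - quat_cnj a"
    have d: "d \<noteq> 0"
      using assms(1) quat_cnj_eq_self_iff[of a] by (auto simp: d_def)
    \<comment> \<open>Here \<open>d\<close> equals \<open>2 * a - t\<close> with \<open>t\<close>
      central.\<close>
    have "d * a = a * d"
      by (simp add: d_def cnj_a algebra_simps t_comm)
    then have comm: "a * inverse d = inverse d * a"
      by (metis d mult.assoc left_inverse right_inverse mult_1_left mult_1_right)
    have "c * b = t * c - c * (t - b)"
      by (simp add: algebra_simps t_comm)
    also have "\<dots> = quat_cnj a * c"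
      using ac by (simp add: cnj_a cnj_b algebra_simps)
    finally have "a * c - c * b = d * c"
      by (simp add: d_def algebra_simps)
    \<comment> \<open>Moving \<open>inverse d\<close> to the left past \<open>a\<close> leaves
      \<open>inverse d * (d * c)\<close>.\<close>
    moreover have "a * (inverse d * c) - inverse d * c * b = inverse d * (a * c - c * b)"
      by (simp add: comm right_diff_distrib flip: mult.assoc)
    ultimately have "a * (inverse d * c) - inverse d * c * b = c"
      using d by (simp flip: mult.assoc)
    then show "\<exists>x. a * x - x * b = c" by blast
  }
qed

end
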